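(* Let $k$ be an algebraically closed field of characteristic zero, let $R=k[x_1,\dots,x_n]$ and $\Gamma=k[X_1,\dots,X_n]$, where $\Gamma$ is regarded as an $R$-module via the apolarity action $\circ$. For $1\le i\le n$, let $\Gamma_i=k[X_1,\dots,X_i]$, a submodule of $\Gamma$, and let $J_i=\langle x_{i+1},x_{i+2},\dots,x_n\rangle$, an ideal of $R$. Then: 1. If $J$ is an ideal of $R$ contained in $J_i$, then $\Gamma_i$ is $J$-reduced and $\Gamma_i\subseteq J^\perp$. 2. If $W$ is a submodule of $\Gamma$ contained in $\Gamma_i$, then $W$ is $J_i$-reduced and $J_i\subseteq W^\perp$. 3. $\mathfrak{R}_{J_i}(\Gamma)=\Gamma_i\subseteq J_i^\perp$. 4. $\mathfrak{R}(\Gamma)=k$.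
   Context: The apolarity action of $R$ on $\Gamma$ is the $k$-bilinear action determined on monomials by $x^\alpha\circ X^\beta=\frac{\beta!}{(\beta-\alpha)!}X^{\beta-\alpha}$ if $\beta_j\ge\alpha_j$ for all $j=1,\dots,n$, and $x^\alpha\circ X^\beta=0$ otherwise, where $x^\alpha=x_1^{\alpha_1}\cdots x_n^{\alpha_n}$, $X^\beta=X_1^{\beta_1}\cdots X_n^{\beta_n}$ and $\beta!=\prod_j\beta_j!$. For an ideal $J\subseteq R$, $J^\perp=\{\gamma\in\Gamma : J\circ\gamma=0\}$; for a submodule $W\subseteq\Gamma$, $W^\perp=\{r\in R: r\circ W=0\}$. For an ideal $J$ of $R$, an $R$-module $N$ is $J$-reduced if for all $m\in N$, $J^2m=0$ implies $Jm=0$. $\mathfrak{R}_J(N)$ denotes the largest $J$-reduced submodule of $N$ (its existence, for $N=\Gamma$ and $J=J_i$, is part of assertion 3). For an $R$-module $N$, $\mathfrak{R}(N)=\{m\in N:\text{for all }a\in R,\ a^2m=0\Rightarrow am=0\}$. In assertion 4, $k$ denotes the constants in $\Gamma$. For $i=n$, $J_n=0$. *)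

theory Defs
  imports
    "HOL-Computational_Algebra.Polynomial"
    "HOL-Algebra.Module"
    "HOL-Algebra.Ideal_Product"
    "HOL-Library.Poly_Mapping"
begin

section \<open>Polynomials\<close>

text \<open>
  A polynomial in variables indexed by natural numbers is a finitely supported map from exponent
  vectors to coefficients; exponent vectors are themselves finitely supported. The library's sum
  and (convolution) product on this type are those of polynomials. The same type carries the
  lower-case \<open>x\<^sub>j\<close> (elements of \<open>R\<close>) and the upper-case \<open>X\<^sub>j\<close> (elements of \<open>\<Gamma>\<close>).
\<close>

type_synonym expo = "nat \<Rightarrow>\<^sub>0 nat"
type_synonym 'k mpoly = "expo \<Rightarrow>\<^sub>0 'k"

definition polys_in :: "nat set \<Rightarrow> 'k::zero mpoly set" where
  "polys_in V = {p. \<forall>\<alpha>\<in>Poly_Mapping.keys p. Poly_Mapping.keys \<alpha> \<subseteq> V}"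

definition Const :: "'k::zero \<Rightarrow> 'k mpoly" where
  "Const c = Poly_Mapping.single 0 c"

definition Var :: "nat \<Rightarrow> 'k::zero_neq_one mpoly" where
  "Var j = Poly_Mapping.single (Poly_Mapping.single j 1) 1"

definition polynomial_ring :: "nat \<Rightarrow> 'k::field mpoly ring" where
  "polynomial_ring n =
     \<lparr>carrier = polys_in {1..n}, mult = (*), one = 1, zero = 0, add = (+)\<rparr>"


section \<open>Apolarity\<close>

text \<open>Indices outside the support contribute \<open>0! = 1\<close> to \<open>\<beta>!\<close>.\<close>

definition expo_fact :: "expo \<Rightarrow> 'k::field_char_0" where
  "expo_fact \<beta> = (\<Prod>j\<in>Poly_Mapping.keys \<beta>. fact (Poly_Mapping.lookup \<beta> j))"

text \<open>
  The order \<open>\<le>\<close> that the library puts on finitely supported functions is lexicographic, so the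
  componentwise order is needed separately. Subtraction of exponent vectors is componentwise.
\<close>

definition expo_le :: "expo \<Rightarrow> expo \<Rightarrow> bool" where
  "expo_le \<alpha> \<beta> \<longleftrightarrow> (\<forall>j. Poly_Mapping.lookup \<alpha> j \<le> Poly_Mapping.lookup \<beta> j)"

definition apolar :: "'k::field_char_0 mpoly \<Rightarrow> 'k mpoly \<Rightarrow> 'k mpoly" where
  "apolar r \<gamma> = (\<Sum>\<alpha>\<in>Poly_Mapping.keys r. \<Sum>\<beta>\<in>Poly_Mapping.keys \<gamma>.
     if expo_le \<alpha> \<beta>
     then Poly_Mapping.single (\<beta> - \<alpha>)
            (Poly_Mapping.lookup r \<alpha> * Poly_Mapping.lookup \<gamma> \<beta> * (expo_fact \<beta> / expo_fact (\<beta> - \<alpha>)))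
     else 0)"

text \<open>The fields \<open>mult\<close> and \<open>one\<close> play no role in a module.\<close>

definition apolar_module :: "nat \<Rightarrow> ('k::field_char_0 mpoly, 'k mpoly) module" where
  "apolar_module n =
     \<lparr>carrier = polys_in {1..n}, mult = (*), one = 1, zero = 0, add = (+), smult = apolar\<rparr>"

definition tail_ideal :: "nat \<Rightarrow> nat \<Rightarrow> 'k::field mpoly set" where
  "tail_ideal n i = genideal (polynomial_ring n) (Var ` {i+1..n})"


section \<open>Annihilators and reduced modules\<close>

definition ideal_perp ::
  "('r, 'm, 'z) module_scheme \<Rightarrow> 'r set \<Rightarrow> 'm set" where
  "ideal_perp M J = {m \<in> carrier M. \<forall>r\<in>J. r \<odot>\<^bsub>M\<^esub> m = \<zero>\<^bsub>M\<^esub>}"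

definition module_perp ::
  "('r, 'y) ring_scheme \<Rightarrow> ('r, 'm, 'z) module_scheme \<Rightarrow> 'm set \<Rightarrow> 'r set" where
  "module_perp R M W = {r \<in> carrier R. \<forall>w\<in>W. r \<odot>\<^bsub>M\<^esub> w = \<zero>\<^bsub>M\<^esub>}"

definition J_reduced ::
  "('r, 'y) ring_scheme \<Rightarrow> 'r set \<Rightarrow> ('r, 'm, 'z) module_scheme \<Rightarrow> bool" where
  "J_reduced R J N \<longleftrightarrow>
     (\<forall>m\<in>carrier N. (\<forall>r\<in>ideal_prod R J J. r \<odot>\<^bsub>N\<^esub> m = \<zero>\<^bsub>N\<^esub>) \<longrightarrow> (\<forall>r\<in>J. r \<odot>\<^bsub>N\<^esub> m = \<zero>\<^bsub>N\<^esub>))"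

text \<open>A submodule \<open>W\<close> of \<open>M\<close>, viewed as a module in its own right, is \<open>M\<lparr>carrier := W\<rparr>\<close>.\<close>

definition is_largest_J_reduced_submodule ::
  "('r, 'y) ring_scheme \<Rightarrow> 'r set \<Rightarrow> ('r, 'm, 'z) module_scheme \<Rightarrow> 'm set \<Rightarrow> bool" where
  "is_largest_J_reduced_submodule R J M S \<longleftrightarrow>
     submodule S R M \<and> J_reduced R J (M\<lparr>carrier := S\<rparr>) \<and>
     (\<forall>W. submodule W R M \<and> J_reduced R J (M\<lparr>carrier := W\<rparr>) \<longrightarrow> W \<subseteq> S)"

definition reduced_part ::
  "('r, 'y) ring_scheme \<Rightarrow> ('r, 'm, 'z) module_scheme \<Rightarrow> 'm set" where
  "reduced_part R N =
     {m \<in> carrier N. \<forall>a\<in>carrier R.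
        (a [^]\<^bsub>R\<^esub> (2::nat)) \<odot>\<^bsub>N\<^esub> m = \<zero>\<^bsub>N\<^esub> \<longrightarrow> a \<odot>\<^bsub>N\<^esub> m = \<zero>\<^bsub>N\<^esub>}"

section \<open>\<open>R\<close> is a commutative ring and \<open>\<Gamma>\<close> is an \<open>R\<close>-module\<close>

lemma polys_in_0: "0 \<in> polys_in V"
  by (simp add: polys_in_def)

lemma polys_in_1: "(1::'k::field mpoly) \<in> polys_in V"
  by (simp add: polys_in_def)

lemma polys_in_add: "p \<in> polys_in V \<Longrightarrow> q \<in> polys_in V \<Longrightarrow> p + q \<in> polys_in V"
  for p q :: "'k::field mpoly"
  using Poly_Mapping.keys_add[of p q] by (auto simp: polys_in_def)

lemma polys_in_uminus: "p \<in> polys_in V \<Longrightarrow> - p \<in> polys_in V"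
  for p :: "'k::field mpoly"
  by (simp add: polys_in_def)

lemma polys_in_mult: "p \<in> polys_in V \<Longrightarrow> q \<in> polys_in V \<Longrightarrow> p * q \<in> polys_in V"
  for p q :: "'k::field mpoly"
proof -
  assume a: "p \<in> polys_in V" "q \<in> polys_in V"
  have "Poly_Mapping.keys \<gamma> \<subseteq> V" if "\<gamma> \<in> Poly_Mapping.keys (p * q)" for \<gamma>
  proof -
    from that obtain \<alpha> \<beta> where g: "\<gamma> = \<alpha> + \<beta>" "\<alpha> \<in> Poly_Mapping.keys p" "\<beta> \<in> Poly_Mapping.keys q"
      using keys_mult[of p q] by blast
    then show ?thesis
      using Poly_Mapping.keys_add[of \<alpha> \<beta>] a by (auto simp: polys_in_def)
  qed
  then show ?thesis by (simp add: polys_in_def)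
qed

lemma polys_in_sum: "(\<And>x. x \<in> A \<Longrightarrow> f x \<in> polys_in V) \<Longrightarrow> sum f A \<in> polys_in V"
  for f :: "'a \<Rightarrow> 'k::field mpoly"
  by (induction A rule: infinite_finite_induct) (auto intro: polys_in_add polys_in_0)

lemma cring_polynomial_ring: "cring (polynomial_ring n :: 'k::field mpoly ring)"
proof (rule cringI)
  show "abelian_group (polynomial_ring n :: 'k mpoly ring)"
  proof (rule abelian_groupI)
    fix x :: "'k mpoly" assume "x \<in> carrier (polynomial_ring n)"
    then show "\<exists>y\<in>carrier (polynomial_ring n). y \<oplus>\<^bsub>polynomial_ring n\<^esub> x = \<zero>\<^bsub>polynomial_ring n\<^esub>"
      by (intro bexI[of _ "- x"]) (auto simp: polynomial_ring_def polys_in_uminus)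
  qed (auto simp: polynomial_ring_def polys_in_0 polys_in_add algebra_simps)
  show "Group.comm_monoid (polynomial_ring n :: 'k mpoly ring)"
    by (rule comm_monoidI)
      (auto simp: polynomial_ring_def polys_in_1 polys_in_mult algebra_simps)
qed (auto simp: polynomial_ring_def algebra_simps)

definition apolar_term :: "expo \<Rightarrow> 'k \<Rightarrow> expo \<Rightarrow> 'k \<Rightarrow> 'k::field_char_0 mpoly" where
  "apolar_term \<alpha> a \<beta> b =
     (if expo_le \<alpha> \<beta>
      then Poly_Mapping.single (\<beta> - \<alpha>) (a * b * (expo_fact \<beta> / expo_fact (\<beta> - \<alpha>))) else 0)"

lemma apolar_term_simps [simp]:
  "apolar_term \<alpha> 0 \<beta> b = 0" "apolar_term \<alpha> a \<beta> 0 = 0"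
  by (auto simp: apolar_term_def)

lemma apolar_term_add:
  "apolar_term \<alpha> (a + a') \<beta> b = apolar_term \<alpha> a \<beta> b + apolar_term \<alpha> a' \<beta> b"
  "apolar_term \<alpha> a \<beta> (b + b') = apolar_term \<alpha> a \<beta> b + apolar_term \<alpha> a \<beta> b'"
  by (auto simp: apolar_term_def single_add[symmetric] algebra_simps add_divide_distrib)

lemma apolar_superset:
  assumes "finite A" "finite B" "Poly_Mapping.keys r \<subseteq> A" "Poly_Mapping.keys \<gamma> \<subseteq> B"
  shows "apolar r \<gamma> = (\<Sum>\<alpha>\<in>A. \<Sum>\<beta>\<in>B. apolar_term \<alpha> (Poly_Mapping.lookup r \<alpha>) \<beta> (Poly_Mapping.lookup \<gamma> \<beta>))"
proof -
  have "apolar r \<gamma> = (\<Sum>\<alpha>\<in>Poly_Mapping.keys r. \<Sum>\<beta>\<in>Poly_Mapping.keys \<gamma>. apolar_term \<alpha> (Poly_Mapping.lookup r \<alpha>) \<beta> (Poly_Mapping.lookup \<gamma> \<beta>))"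
    by (simp add: apolar_def apolar_term_def)
  also have "\<dots> = (\<Sum>\<alpha>\<in>Poly_Mapping.keys r. \<Sum>\<beta>\<in>B. apolar_term \<alpha> (Poly_Mapping.lookup r \<alpha>) \<beta> (Poly_Mapping.lookup \<gamma> \<beta>))"
    using assms by (intro sum.cong sum.mono_neutral_left) (auto simp: in_keys_iff)
  also have "\<dots> = (\<Sum>\<alpha>\<in>A. \<Sum>\<beta>\<in>B. apolar_term \<alpha> (Poly_Mapping.lookup r \<alpha>) \<beta> (Poly_Mapping.lookup \<gamma> \<beta>))"
    using assms by (intro sum.mono_neutral_left) (auto simp: in_keys_iff)
  finally show ?thesis .
qed

lemma apolar_add_left: "apolar (r + s) \<gamma> = apolar r \<gamma> + apolar s \<gamma>"
proof -
  let ?A = "Poly_Mapping.keys r \<union> Poly_Mapping.keys s"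
  have "Poly_Mapping.keys (r + s) \<subseteq> ?A" by (rule Poly_Mapping.keys_add)
  then show ?thesis
    by (simp add: apolar_superset[of ?A "Poly_Mapping.keys \<gamma>"] lookup_add apolar_term_add sum.distrib)
qed

lemma apolar_add_right: "apolar r (\<gamma> + \<delta>) = apolar r \<gamma> + apolar r \<delta>"
proof -
  let ?B = "Poly_Mapping.keys \<gamma> \<union> Poly_Mapping.keys \<delta>"
  have "Poly_Mapping.keys (\<gamma> + \<delta>) \<subseteq> ?B" by (rule Poly_Mapping.keys_add)
  then show ?thesis
    by (simp add: apolar_superset[of "Poly_Mapping.keys r" ?B] lookup_add apolar_term_add sum.distrib)
qed

lemma apolar_0 [simp]: "apolar 0 \<gamma> = 0" "apolar r 0 = 0"
  by (simp_all add: apolar_def)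

lemma apolar_sum_left: "apolar (sum f A) \<gamma> = (\<Sum>x\<in>A. apolar (f x) \<gamma>)"
  by (induction A rule: infinite_finite_induct) (auto simp: apolar_add_left)

lemma apolar_sum_right: "apolar r (sum f A) = (\<Sum>x\<in>A. apolar r (f x))"
  by (induction A rule: infinite_finite_induct) (auto simp: apolar_add_right)

lemma apolar_single:
  "apolar (Poly_Mapping.single \<alpha> a) (Poly_Mapping.single \<beta> b) =
     (if expo_le \<alpha> \<beta>
      then Poly_Mapping.single (\<beta> - \<alpha>) (a * b * (expo_fact \<beta> / expo_fact (\<beta> - \<alpha>))) else 0)"
  by (subst apolar_superset[of "{\<alpha>}" "{\<beta>}"]) (auto simp: apolar_term_def)

lemma expo_fact_nonzero [simp]: "expo_fact \<beta> \<noteq> 0"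
  by (simp add: expo_fact_def)

lemma mpoly_sum_single: "(\<Sum>\<alpha>\<in>Poly_Mapping.keys p. Poly_Mapping.single \<alpha> (Poly_Mapping.lookup p \<alpha>)) = p"
  for p :: "'k::field_char_0 mpoly"
  by (rule poly_mapping_eqI) (simp add: lookup_sum lookup_single when_def in_keys_iff)

lemma apolar_assoc_single:
  fixes a b c :: "'k::field_char_0"
  shows "apolar (Poly_Mapping.single \<alpha> a * Poly_Mapping.single \<beta> b) (Poly_Mapping.single \<gamma> c) =
         apolar (Poly_Mapping.single \<alpha> a)
           (apolar (Poly_Mapping.single \<beta> b) (Poly_Mapping.single \<gamma> c))"
proof -
  have 1: "expo_le (\<alpha> + \<beta>) \<gamma> \<longleftrightarrow> expo_le \<beta> \<gamma> \<and> expo_le \<alpha> (\<gamma> - \<beta>)"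
  proof -
    have "x + y \<le> z \<longleftrightarrow> y \<le> z \<and> x \<le> z - y" for x y z :: nat
      by arith
    then show ?thesis
      by (auto simp: expo_le_def lookup_add lookup_minus)
  qed
  have 2: "\<gamma> - (\<alpha> + \<beta>) = \<gamma> - \<beta> - \<alpha>"
    by (rule poly_mapping_eqI) (simp add: lookup_minus lookup_add)
  show ?thesis
    by (auto simp: mult_single apolar_single 1 2 mult_ac)
qed

lemma apolar_assoc: "apolar (r * s) \<gamma> = apolar r (apolar s \<gamma>)"
proof -
  let ?m = "\<lambda>p \<alpha>. Poly_Mapping.single \<alpha> (Poly_Mapping.lookup p \<alpha>)"
  have "apolar ((\<Sum>\<alpha>\<in>Poly_Mapping.keys r. ?m r \<alpha>) * (\<Sum>\<beta>\<in>Poly_Mapping.keys s. ?m s \<beta>)) (\<Sum>\<delta>\<in>Poly_Mapping.keys \<gamma>. ?m \<gamma> \<delta>) =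
        apolar (\<Sum>\<alpha>\<in>Poly_Mapping.keys r. ?m r \<alpha>) (apolar (\<Sum>\<beta>\<in>Poly_Mapping.keys s. ?m s \<beta>) (\<Sum>\<delta>\<in>Poly_Mapping.keys \<gamma>. ?m \<gamma> \<delta>))"
    apply (simp only: sum_product apolar_sum_left apolar_sum_right apolar_assoc_single)
    apply (rule sum.cong [OF refl])
    apply (rule sum.swap)
    done
  then show ?thesis
    by (simp only: mpoly_sum_single)
qed

lemma apolar_one: "apolar 1 \<gamma> = \<gamma>"
proof -
  let ?m = "\<lambda>p \<alpha>. Poly_Mapping.single \<alpha> (Poly_Mapping.lookup p \<alpha>)"
  have "apolar 1 (\<Sum>\<delta>\<in>Poly_Mapping.keys \<gamma>. ?m \<gamma> \<delta>) = (\<Sum>\<delta>\<in>Poly_Mapping.keys \<gamma>. ?m \<gamma> \<delta>)"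
    by (simp only: apolar_sum_right single_one[symmetric] apolar_single)
      (simp add: expo_le_def)
  then show ?thesis
    by (simp only: mpoly_sum_single)
qed

lemma apolar_polys_in: "\<gamma> \<in> polys_in V \<Longrightarrow> apolar r \<gamma> \<in> polys_in V"
proof -
  assume a: "\<gamma> \<in> polys_in V"
  have "Poly_Mapping.keys (\<beta> - \<alpha>) \<subseteq> V" if "\<beta> \<in> Poly_Mapping.keys \<gamma>" for \<beta> \<alpha>
  proof -
    have "Poly_Mapping.keys (\<beta> - \<alpha>) \<subseteq> Poly_Mapping.keys \<beta>"
      by (auto simp: in_keys_iff lookup_minus)
    with a that show ?thesis by (auto simp: polys_in_def)
  qed
  then have "Poly_Mapping.single (\<beta> - \<alpha>) c \<in> polys_in V" if "\<beta> \<in> Poly_Mapping.keys \<gamma>" for \<beta> \<alpha> and c :: 'a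
    using that by (auto simp: polys_in_def)
  then show ?thesis
    unfolding apolar_def by (auto intro!: polys_in_sum simp: polys_in_0)
qed

lemma apolar_module_is_module:
  "Module.module (polynomial_ring n) (apolar_module n :: ('k::field_char_0 mpoly, 'k mpoly) module)"
proof (rule moduleI)
  show "cring (polynomial_ring n :: 'k mpoly ring)"
    by (rule cring_polynomial_ring)
  show "abelian_group (apolar_module n :: ('k mpoly, 'k mpoly) module)"
  proof (rule abelian_groupI)
    fix x :: "'k mpoly" assume "x \<in> carrier (apolar_module n)"
    then show "\<exists>y\<in>carrier (apolar_module n). y \<oplus>\<^bsub>apolar_module n\<^esub> x = \<zero>\<^bsub>apolar_module n\<^esub>"
      by (intro bexI[of _ "- x"]) (auto simp: apolar_module_def polys_in_uminus)
  qed (auto simp: apolar_module_def polys_in_0 polys_in_add algebra_simps)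
qed (auto simp: polynomial_ring_def apolar_module_def apolar_polys_in apolar_add_left
        apolar_add_right apolar_assoc apolar_one)

end

theory Submission
  imports Defs
begin

text \<open>
  Since \<open>x\<^sub>j \<circ> \<gamma>\<close> is the partial derivative \<open>\<partial>\<gamma>/\<partial>X\<^sub>j\<close>, the ideal \<open>J\<^sub>i\<close> annihilates \<open>\<Gamma>\<^sub>i\<close>, and every
  reducedness claim inside \<open>\<Gamma>\<^sub>i\<close> is immediate. Conversely, let \<open>W\<close> be a \<open>J\<^sub>i\<close>-reduced submodule of
  \<open>\<Gamma>\<close> and \<open>m \<in> W\<close>. By induction on the degree, \<open>x\<^sub>j \<circ> m \<in> \<Gamma>\<^sub>i\<close> for all \<open>j > i\<close>; hence \<open>J\<^sub>i\<^sup>2 \<circ> m = 0\<close>,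
  so \<open>J\<^sub>i \<circ> m = 0\<close>, and in characteristic zero vanishing derivatives mean that \<open>m \<in> \<Gamma>\<^sub>i\<close>.
  For \<open>m \<in> \<RR>(\<Gamma>)\<close>, the least \<open>N\<close> with \<open>x\<^sub>j\<^sup>N \<circ> m = 0\<close> cannot be \<open>2\<close> or more, as \<open>a = x\<^sub>j\<^sup>N\<^sup>-\<^sup>1\<close>
  would violate reducedness; so all derivatives of \<open>m\<close> vanish.
\<close>

section \<open>Carriers and operations of the ring and the module\<close>

lemma polynomial_ring_simps [simp]:
  "carrier (polynomial_ring n) = polys_in {1..n}"
  "x \<otimes>\<^bsub>polynomial_ring n\<^esub> y = x * y"
  "x \<oplus>\<^bsub>polynomial_ring n\<^esub> y = x + y"
  "\<zero>\<^bsub>polynomial_ring n\<^esub> = 0"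
  "\<one>\<^bsub>polynomial_ring n\<^esub> = 1"
  by (simp_all add: polynomial_ring_def)

lemma apolar_module_simps [simp]:
  "carrier (apolar_module n) = polys_in {1..n}"
  "x \<oplus>\<^bsub>apolar_module n\<^esub> y = x + y"
  "\<zero>\<^bsub>apolar_module n\<^esub> = 0"
  "x \<odot>\<^bsub>apolar_module n\<^esub> y = apolar x y"
  by (simp_all add: apolar_module_def)

lemma polys_in_mono: "V \<subseteq> V' \<Longrightarrow> polys_in V \<subseteq> polys_in V'"
  by (auto simp: polys_in_def)

lemma Var_in_polys_in: "j \<in> V \<Longrightarrow> (Var j :: 'k::field mpoly) \<in> polys_in V"
  by (auto simp: polys_in_def Var_def)

section \<open>Variables acting as partial derivatives\<close>

lemma expo_fact_superset:
  assumes "finite A" "Poly_Mapping.keys \<beta> \<subseteq> A"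
  shows "expo_fact \<beta> = (\<Prod>j\<in>A. fact (Poly_Mapping.lookup \<beta> j))"
  unfolding expo_fact_def
  by (rule prod.mono_neutral_left) (use assms in \<open>auto simp: in_keys_iff\<close>)

lemma expo_fact_add_single:
  "expo_fact (\<gamma> + Poly_Mapping.single j 1) =
     (of_nat (Suc (Poly_Mapping.lookup \<gamma> j)) * expo_fact \<gamma> :: 'k::field_char_0)"
proof -
  let ?A = "insert j (Poly_Mapping.keys \<gamma>)"
  have "Poly_Mapping.keys (\<gamma> + Poly_Mapping.single j 1) \<subseteq> ?A"
    using Poly_Mapping.keys_add[of \<gamma> "Poly_Mapping.single j 1"] by auto
  then have "expo_fact (\<gamma> + Poly_Mapping.single j 1) =
      (\<Prod>l\<in>?A. fact (Poly_Mapping.lookup (\<gamma> + Poly_Mapping.single j 1) l) :: 'k)"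
    by (intro expo_fact_superset) auto
  also have "\<dots> = fact (Suc (Poly_Mapping.lookup \<gamma> j)) *
      (\<Prod>l\<in>?A - {j}. fact (Poly_Mapping.lookup \<gamma> l))"
    by (subst prod.remove[of _ j]) (auto simp: lookup_add lookup_single when_def intro!: prod.cong)
  also have "\<dots> = of_nat (Suc (Poly_Mapping.lookup \<gamma> j)) *
      (\<Prod>l\<in>?A. fact (Poly_Mapping.lookup \<gamma> l))"
    by (subst prod.remove[of ?A j]) (auto simp: mult.assoc)
  also have "(\<Prod>l\<in>?A. fact (Poly_Mapping.lookup \<gamma> l)) = (expo_fact \<gamma> :: 'k)"
    by (intro expo_fact_superset[symmetric]) auto
  finally show ?thesis .
qed

text \<open>The coefficient formula for the derivative by \<open>X\<^sub>j\<close>: lowering the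
  exponent of \<open>X\<^sub>j\<close> by one is injective where it is defined, so a single monomial
  of \<open>m\<close> contributes, and the quotient of factorials leaves one integer factor.\<close>

lemma lookup_apolar_Var:
  fixes m :: "'k::field_char_0 mpoly"
  shows "Poly_Mapping.lookup (apolar (Var j) m) \<gamma> =
     of_nat (Suc (Poly_Mapping.lookup \<gamma> j)) * Poly_Mapping.lookup m (\<gamma> + Poly_Mapping.single j 1)"
proof -
  let ?e = "Poly_Mapping.single j (1::nat)"
  have lookup_term: "Poly_Mapping.lookup (apolar (Var j) (Poly_Mapping.single \<beta> b)) \<gamma> =
      (of_nat (Suc (Poly_Mapping.lookup \<gamma> j)) * b when \<beta> = \<gamma> + ?e)" for \<beta> and b :: 'k
  proof (cases "expo_le ?e \<beta>")
    case True
    \<comment> \<open>Subtraction of exponents is truncated; it is undone here because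
      \<open>X\<^sub>j\<close> divides the monomial.\<close>
    have "\<beta> = (\<beta> - ?e) + ?e"
      using True
      by (intro poly_mapping_eqI)
        (auto simp: expo_le_def lookup_add lookup_minus lookup_single when_def)
    then obtain \<delta> where \<delta>: "\<beta> = \<delta> + ?e" by blast
    show ?thesis
      using True unfolding \<delta> Var_def
      by (simp add: apolar_single expo_fact_add_single[simplified] lookup_single when_def)
  next
    case False
    then have "\<beta> \<noteq> \<gamma> + ?e"
      by (auto simp: expo_le_def lookup_add)
    with False show ?thesis
      by (simp add: Var_def apolar_single)
  qed
  have "Poly_Mapping.lookup (apolar (Var j) m) \<gamma> = Poly_Mapping.lookup (apolar (Var j)
      (\<Sum>\<beta>\<in>Poly_Mapping.keys m. Poly_Mapping.single \<beta> (Poly_Mapping.lookup m \<beta>))) \<gamma>"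
    by (simp only: mpoly_sum_single)
  also have "\<dots> = (\<Sum>\<beta>\<in>Poly_Mapping.keys m.
      of_nat (Suc (Poly_Mapping.lookup \<gamma> j)) * Poly_Mapping.lookup m \<beta> when \<beta> = \<gamma> + ?e)"
    by (simp only: apolar_sum_right lookup_sum lookup_term)
  also have "\<dots> = of_nat (Suc (Poly_Mapping.lookup \<gamma> j)) * Poly_Mapping.lookup m (\<gamma> + ?e)"
    by (simp add: when_def in_keys_iff)
  finally show ?thesis .
qed

text \<open>Characteristic zero enters here: the integer factor of a derivative is a successor,
  hence nonzero in the field, so no monomial containing \<open>X\<^sub>j\<close> is killed.\<close>

lemma apolar_Var_eq_0_iff:
  fixes m :: "'k::field_char_0 mpoly"
  shows "apolar (Var j) m = 0 \<longleftrightarrow> (\<forall>\<beta>\<in>Poly_Mapping.keys m. j \<notin> Poly_Mapping.keys \<beta>)"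
proof
  assume 0: "apolar (Var j) m = 0"
  show "\<forall>\<beta>\<in>Poly_Mapping.keys m. j \<notin> Poly_Mapping.keys \<beta>"
  proof (intro ballI notI)
    fix \<beta> assume \<beta>: "\<beta> \<in> Poly_Mapping.keys m" "j \<in> Poly_Mapping.keys \<beta>"
    have "\<beta> = (\<beta> - Poly_Mapping.single j 1) + Poly_Mapping.single j 1"
      using \<beta>(2)
      by (intro poly_mapping_eqI) (auto simp: in_keys_iff lookup_add lookup_minus lookup_single when_def)
    then have "of_nat (Suc (Poly_Mapping.lookup (\<beta> - Poly_Mapping.single j 1) j)) *
        Poly_Mapping.lookup m \<beta> = (0 :: 'k)"
      using lookup_apolar_Var[of j m "\<beta> - Poly_Mapping.single j 1"] 0 by simp
    then have "Poly_Mapping.lookup m \<beta> = 0"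
      by (simp only: mult_eq_0_iff of_nat_eq_0_iff) simp
    with \<beta>(1) show False by (simp add: in_keys_iff)
  qed
next
  assume keys: "\<forall>\<beta>\<in>Poly_Mapping.keys m. j \<notin> Poly_Mapping.keys \<beta>"
  show "apolar (Var j) m = 0"
  proof (rule poly_mapping_eqI)
    fix \<gamma> :: expo
    have "j \<in> Poly_Mapping.keys (\<gamma> + Poly_Mapping.single j 1)"
      by (simp add: in_keys_iff lookup_add)
    with keys have "\<gamma> + Poly_Mapping.single j 1 \<notin> Poly_Mapping.keys m" by blast
    then show "Poly_Mapping.lookup (apolar (Var j) m) \<gamma> = Poly_Mapping.lookup 0 \<gamma>"
      by (simp add: lookup_apolar_Var in_keys_iff)
  qed
qed

lemma polys_in_atMost_iff_apolar_Var:
  fixes m :: "'k::field_char_0 mpoly"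
  assumes "i \<le> n"
  shows "m \<in> polys_in {1..i} \<longleftrightarrow>
    m \<in> polys_in {1..n} \<and> (\<forall>j\<in>{i+1..n}. apolar (Var j) m = 0)"
proof -
  have "{1..i} = {1..n} - {i+1..n}"
    using assms by auto
  then show ?thesis
    unfolding apolar_Var_eq_0_iff polys_in_def by blast
qed

section \<open>Degree bounds and nilpotency of derivatives\<close>

text \<open>Bounds the degree strictly, so that only \<open>0\<close> has degree below \<open>0\<close>.\<close>

definition degree_less :: "nat \<Rightarrow> nat \<Rightarrow> 'k::zero mpoly \<Rightarrow> bool" where
  "degree_less n d m \<longleftrightarrow>
     (\<forall>\<beta>\<in>Poly_Mapping.keys m. (\<Sum>j=1..n. Poly_Mapping.lookup \<beta> j) < d)"

lemma degree_less_0_iff: "degree_less n 0 m \<longleftrightarrow> m = 0"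
  by (simp add: degree_less_def)

lemma ex_degree_less: "\<exists>d. degree_less n d m"
proof
  let ?d = "\<lambda>\<beta>. \<Sum>j=1..n. Poly_Mapping.lookup \<beta> j"
  \<comment> \<open>The sum of the degrees of all monomials bounds each of them; \<open>Suc\<close>
    makes the bound strict.\<close>
  show "degree_less n (Suc (\<Sum>\<beta>\<in>Poly_Mapping.keys m. ?d \<beta>)) m"
    unfolding degree_less_def less_Suc_eq_le by (intro ballI member_le_sum) auto
qed

lemma degree_less_apolar_Var:
  fixes m :: "'k::field_char_0 mpoly"
  assumes "degree_less n (Suc d) m" "j \<in> {1..n}"
  shows "degree_less n d (apolar (Var j) m)"
  unfolding degree_less_def
proof
  fix \<gamma> assume "\<gamma> \<in> Poly_Mapping.keys (apolar (Var j) m)"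
  then have "\<gamma> + Poly_Mapping.single j 1 \<in> Poly_Mapping.keys m"
    by (simp add: in_keys_iff lookup_apolar_Var)
  with assms(1) have "(\<Sum>l=1..n. Poly_Mapping.lookup (\<gamma> + Poly_Mapping.single j 1) l) < Suc d"
    unfolding degree_less_def by blast
  moreover have "(\<Sum>l=1..n. Poly_Mapping.lookup (Poly_Mapping.single j (1::nat)) l) = 1"
    using assms(2) by (simp add: lookup_single when_def)
  ultimately show "(\<Sum>l=1..n. Poly_Mapping.lookup \<gamma> l) < d"
    by (simp add: lookup_add sum.distrib)
qed

lemma apolar_Var_power_eq_0:
  fixes m :: "'k::field_char_0 mpoly"
  assumes "degree_less n d m" "j \<in> {1..n}"
  shows "apolar (Var j ^ d) m = 0"
  using assms(1)
proof (induction d arbitrary: m)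
  case 0
  then show ?case by (simp add: degree_less_0_iff)
next
  case (Suc d)
  then show ?case
    using degree_less_apolar_Var[OF Suc.prems assms(2)]
    by (simp add: power_Suc2 apolar_assoc del: power_Suc)
qed

section \<open>The action of generated ideals and of their products\<close>

text \<open>This is the colon ideal of \<open>S\<close> by \<open>m\<close>. It is needed for
  \<open>S = {0}\<close>, where it is the annihilator of \<open>m\<close>, and for \<open>S\<close>
  the polynomials in the first \<open>i\<close> variables.\<close>

lemma ideal_apolar_in:
  fixes S :: "'k::field_char_0 mpoly set"
  assumes "0 \<in> S" "\<And>p q. p \<in> S \<Longrightarrow> q \<in> S \<Longrightarrow> p + q \<in> S" "\<And>r p. p \<in> S \<Longrightarrow> apolar r p \<in> S"
  shows "ideal {r \<in> polys_in {1..n}. apolar r m \<in> S} (polynomial_ring n)"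
proof -
  interpret cring "polynomial_ring n :: 'k mpoly ring" by (rule cring_polynomial_ring)
  let ?I = "{r \<in> polys_in {1..n}. apolar r m \<in> S}"
  have mult: "r * s \<in> ?I" if "s \<in> ?I" "r \<in> polys_in {1..n}" for r s
    using that assms(3) by (simp add: polys_in_mult apolar_assoc)
  show ?thesis
  proof (rule idealI)
    show "subgroup ?I (add_monoid (polynomial_ring n))"
    proof (rule add.subgroupI)
      fix r assume r: "r \<in> ?I"
      then have "r \<in> carrier (polynomial_ring n)" by simp
      \<comment> \<open>Closure under negation comes from multiplying by the constant
        \<open>- 1\<close>.\<close>
      moreover have "- r \<in> ?I"
        using mult[OF r, of "- 1"] by (simp add: polys_in_uminus polys_in_1)
      ultimately show "\<ominus>\<^bsub>polynomial_ring n\<^esub> r \<in> ?I"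
        using minus_equality[of "- r" r] by auto
    qed (use assms in \<open>auto simp: polys_in_0 polys_in_add apolar_add_left intro!: exI[of _ 0]\<close>)
    show "x \<otimes>\<^bsub>polynomial_ring n\<^esub> r \<in> ?I" "r \<otimes>\<^bsub>polynomial_ring n\<^esub> x \<in> ?I"
      if "r \<in> ?I" "x \<in> carrier (polynomial_ring n)" for r x
      using mult[of r x] that by (simp_all add: mult.commute)
  qed (rule ring_axioms)
qed

lemma Var_in_tail_ideal:
  assumes "j \<in> {i+1..n}"
  shows "(Var j :: 'k::field mpoly) \<in> tail_ideal n i"
proof -
  interpret cring "polynomial_ring n :: 'k mpoly ring" by (rule cring_polynomial_ring)
  have "Var ` {i+1..n} \<subseteq> carrier (polynomial_ring n :: 'k mpoly ring)"
    by (auto intro!: Var_in_polys_in)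
  from genideal_self[OF this] show ?thesis
    using assms by (auto simp: tail_ideal_def)
qed

lemma ideal_tail_ideal: "ideal (tail_ideal n i :: 'k::field mpoly set) (polynomial_ring n)"
proof -
  interpret cring "polynomial_ring n :: 'k mpoly ring" by (rule cring_polynomial_ring)
  show ?thesis
    unfolding tail_ideal_def by (rule genideal_ideal) (auto intro!: Var_in_polys_in)
qed

text \<open>The colon ideal contains the generators, so it contains the ideal they generate; only
  the variables have to be checked.\<close>

lemma tail_ideal_apolar_in:
  fixes S :: "'k::field_char_0 mpoly set"
  assumes "0 \<in> S" "\<And>p q. p \<in> S \<Longrightarrow> q \<in> S \<Longrightarrow> p + q \<in> S" "\<And>r p. p \<in> S \<Longrightarrow> apolar r p \<in> S"
    and "\<And>j. j \<in> {i+1..n} \<Longrightarrow> apolar (Var j) m \<in> S" and "r \<in> tail_ideal n i"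
  shows "apolar r m \<in> S"
proof -
  interpret cring "polynomial_ring n :: 'k mpoly ring" by (rule cring_polynomial_ring)
  have "tail_ideal n i \<subseteq> {r \<in> polys_in {1..n}. apolar r m \<in> S}"
    unfolding tail_ideal_def
    by (rule genideal_minimal[OF ideal_apolar_in])
      (use assms in \<open>auto intro!: Var_in_polys_in\<close>)
  with assms(5) show ?thesis by blast
qed

lemma tail_ideal_annihilates:
  fixes m :: "'k::field_char_0 mpoly"
  assumes "i \<le> n" "m \<in> polys_in {1..i}" "r \<in> tail_ideal n i"
  shows "apolar r m = 0"
  using tail_ideal_apolar_in[of "{0}" i n m r] polys_in_atMost_iff_apolar_Var[OF assms(1), of m] assms
  by auto

lemma ideal_prod_annihilates:
  fixes m :: "'k::field_char_0 mpoly"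
  assumes "\<And>r s. r \<in> I \<Longrightarrow> s \<in> J \<Longrightarrow> apolar r (apolar s m) = 0"
    and "t \<in> ideal_prod (polynomial_ring n) I J"
  shows "apolar t m = 0"
  using assms(2) by induction (auto simp: assms(1) apolar_assoc apolar_add_left)

section \<open>Polynomials in the first \<open>i\<close> variables as the largest reduced
  submodule\<close>

lemma submodule_polys_in:
  assumes "i \<le> n"
  shows "submodule (polys_in {1..i} :: 'k::field_char_0 mpoly set)
    (polynomial_ring n) (apolar_module n)"
proof -
  interpret Module.module "polynomial_ring n" "apolar_module n :: ('k mpoly, 'k mpoly) module"
    by (rule apolar_module_is_module)
  have sub: "polys_in {1..i} \<subseteq> (polys_in {1..n} :: 'k mpoly set)"
    using assms by (intro polys_in_mono) auto
  show ?thesis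
  proof (rule module.submoduleI[OF apolar_module_is_module])
    fix m :: "'k mpoly" assume m: "m \<in> polys_in {1..i}"
    then have "\<ominus>\<^bsub>apolar_module n\<^esub> m = - m"
      using M.minus_equality[of "- m" m] sub by (auto simp: polys_in_uminus)
    with m show "\<ominus>\<^bsub>apolar_module n\<^esub> m \<in> polys_in {1..i}"
      by (simp add: polys_in_uminus)
  qed (use sub in \<open>auto simp: polys_in_0 polys_in_add apolar_polys_in\<close>)
qed

lemma J_reduced_submodule_subset:
  fixes W :: "'k::field_char_0 mpoly set"
  assumes "i \<le> n" and W: "submodule W (polynomial_ring n) (apolar_module n)"
    and red: "J_reduced (polynomial_ring n) (tail_ideal n i) (apolar_module n\<lparr>carrier := W\<rparr>)"
  shows "W \<subseteq> polys_in {1..i}"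
proof
  fix m assume "m \<in> W"
  obtain d where "degree_less n d m"
    using ex_degree_less by blast
  then show "m \<in> polys_in {1..i}"
    using \<open>m \<in> W\<close>
  proof (induction d arbitrary: m)
    case 0
    then show ?case by (simp add: degree_less_0_iff polys_in_0)
  next
    case (Suc d)
    \<comment> \<open>The induction hypothesis applies to the derivative because its degree bound
      drops and it stays in the submodule \<open>W\<close>.\<close>
    have "apolar (Var j) m \<in> polys_in {1..i}" if j: "j \<in> {i+1..n}" for j
    proof (rule Suc.IH)
      show "degree_less n d (apolar (Var j) m)"
        using Suc.prems(1) j by (intro degree_less_apolar_Var) auto
      show "apolar (Var j) m \<in> W"
        using submodule.smult_closed[OF W, of "Var j" m] Suc.prems(2) j
          Var_in_polys_in[of j "{1..n}", where 'k = 'k]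
        by simp
    qed
    then have "apolar s m \<in> polys_in {1..i}" if "s \<in> tail_ideal n i" for s
      by (rule tail_ideal_apolar_in[OF _ _ _ _ that, rotated 3])
        (auto intro: polys_in_0 polys_in_add apolar_polys_in)
    \<comment> \<open>For a product of two elements of the ideal, the first to act sends
      \<open>m\<close> into the polynomials in the first \<open>i\<close> variables, and the second
      annihilates those.\<close>
    then have "apolar t m = 0"
      if "t \<in> ideal_prod (polynomial_ring n) (tail_ideal n i) (tail_ideal n i)" for t
      using tail_ideal_annihilates[OF assms(1)] by (intro ideal_prod_annihilates[OF _ that]) auto
    with red Suc.prems(2) have "apolar r m = 0" if "r \<in> tail_ideal n i" for r
      using that by (auto simp: J_reduced_def)
    moreover have "m \<in> polys_in {1..n}"
      using subgroup.subset[OF submodule.axioms(1)[OF W]] Suc.prems(2) by auto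
    ultimately show ?case
      using polys_in_atMost_iff_apolar_Var[OF assms(1)] Var_in_tail_ideal by blast
  qed
qed

section \<open>Constants and the reduced part\<close>

text \<open>Seen as polynomials in no variables, the constants fall under the criterion by vanishing
  derivatives, with \<open>i = 0\<close>.\<close>

lemma range_Const: "range Const = polys_in {}"
proof -
  have "m \<in> range Const" if "m \<in> polys_in {}" for m :: "'a mpoly"
  proof (rule range_eqI)
    have "Poly_Mapping.lookup m \<alpha> = 0" if "\<alpha> \<noteq> 0" for \<alpha>
      using \<open>m \<in> polys_in {}\<close> that by (auto simp: polys_in_def in_keys_iff)
    then show "m = Const (Poly_Mapping.lookup m 0)"
      by (intro poly_mapping_eqI) (auto simp: Const_def lookup_single when_def)
  qed
  moreover have "Const c \<in> polys_in {}" for c :: 'a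
    by (simp add: Const_def polys_in_def)
  ultimately show ?thesis by blast
qed

lemma Const_eq_0_iff: "Const c = 0 \<longleftrightarrow> c = 0"
  unfolding Const_def by (metis lookup_single_eq lookup_zero single_zero)

text \<open>Every nonconstant monomial of \<open>a\<close> differentiates a constant to zero, so
  \<open>a\<close> acts through its constant term.\<close>

lemma apolar_Const:
  fixes a :: "'k::field_char_0 mpoly"
  shows "apolar a (Const c) = Const (Poly_Mapping.lookup a 0 * c)"
proof -
  have le: "expo_le \<alpha> 0 \<longleftrightarrow> \<alpha> = 0" for \<alpha>
    by (auto simp: expo_le_def intro: poly_mapping_eqI)
  have "apolar a (Const c) = apolar (\<Sum>\<alpha>\<in>Poly_Mapping.keys a.
      Poly_Mapping.single \<alpha> (Poly_Mapping.lookup a \<alpha>)) (Const c)"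
    by (simp only: mpoly_sum_single)
  also have "\<dots> = (\<Sum>\<alpha>\<in>Poly_Mapping.keys a.
      if \<alpha> = 0 then Const (Poly_Mapping.lookup a 0 * c) else 0)"
    unfolding apolar_sum_left Const_def apolar_single le by (intro sum.cong) auto
  also have "\<dots> = Const (Poly_Mapping.lookup a 0 * c)"
    by (auto simp: Const_def in_keys_iff)
  finally show ?thesis .
qed

lemma polynomial_ring_pow [simp]: "a [^]\<^bsub>polynomial_ring n\<^esub> (k::nat) = a ^ k"
proof -
  interpret cring "polynomial_ring n :: 'a mpoly ring" by (rule cring_polynomial_ring)
  show ?thesis
    by (induction k) (simp_all add: power_Suc2 del: power_Suc)
qed

lemma reduced_part_apolar_module:
  "reduced_part (polynomial_ring n) (apolar_module n) = range (Const :: 'k::field_char_0 \<Rightarrow> _)"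
proof (intro equalityI subsetI)
  fix m :: "'k mpoly" assume "m \<in> reduced_part (polynomial_ring n) (apolar_module n)"
  then have m: "m \<in> polys_in {1..n}"
    and red: "\<And>a. a \<in> polys_in {1..n} \<Longrightarrow> apolar (a ^ 2) m = 0 \<Longrightarrow> apolar a m = 0"
    by (auto simp: reduced_part_def)
  have "apolar (Var j) m = 0" if j: "j \<in> {1..n}" for j
  proof -
    define N where "N = (LEAST d. apolar (Var j ^ d) m = 0)"
    have ex: "\<exists>d. apolar (Var j ^ d) m = 0"
      using ex_degree_less apolar_Var_power_eq_0[OF _ j] by blast
    have N: "apolar (Var j ^ N) m = 0"
      unfolding N_def using ex by (rule LeastI_ex)
    have "N < 2"
    proof (rule ccontr)
      assume "\<not> N < 2"
      \<comment> \<open>As \<open>N\<close> is at least 2, the square of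
        \<open>Var j ^ (N - 1)\<close> contains the factor \<open>Var j ^ N\<close>, which already
        kills \<open>m\<close>.\<close>
      then have l: "(N - 1) * 2 = (N - 2) + N"
        by simp
      have "apolar ((Var j ^ (N - 1)) ^ 2) m = 0"
        unfolding power_mult[symmetric] l power_add apolar_assoc N by simp
      moreover have "Var j ^ k \<in> (polys_in {1..n} :: 'k mpoly set)" for k
        using j by (induction k) (auto intro!: polys_in_mult polys_in_1 Var_in_polys_in)
      ultimately have "apolar (Var j ^ (N - 1)) m = 0"
        using red by blast
      then have "N \<le> N - 1"
        unfolding N_def by (rule Least_le)
      with \<open>\<not> N < 2\<close> show False by simp
    qed
    \<comment> \<open>If \<open>N = 0\<close>, then \<open>m\<close> itself is zero; if
      \<open>N = 1\<close>, the claim is the choice of \<open>N\<close>.\<close>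
    then show ?thesis
      using N by (auto simp: less_2_cases_iff apolar_one)
  qed
  then have "m \<in> polys_in {1..0}"
    using polys_in_atMost_iff_apolar_Var[of 0 n m] m by simp
  then show "m \<in> range Const"
    by (simp add: range_Const)
next
  fix m :: "'k mpoly" assume "m \<in> range Const"
  moreover from this have "m \<in> polys_in {1..n}"
    using polys_in_mono[of "{}" "{1..n}"] by (auto simp: range_Const)
  ultimately show "m \<in> reduced_part (polynomial_ring n) (apolar_module n)"
    \<comment> \<open>Squaring \<open>a\<close> squares the scalar by which it acts on constants,
      and a field has no nonzero nilpotents.\<close>
    by (auto simp: reduced_part_def power2_eq_square apolar_assoc apolar_Const Const_eq_0_iff)
qed

theorem theorem3p1:
  fixes n i :: nat
    and R :: "'k::{alg_closed_field, field_char_0} mpoly ring"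
    and \<Gamma> :: "('k mpoly, 'k mpoly) module"
    and \<Gamma>\<^sub>i J\<^sub>i :: "'k mpoly set"
  defines "R \<equiv> polynomial_ring n"
    and "\<Gamma> \<equiv> apolar_module n"
    and "\<Gamma>\<^sub>i \<equiv> polys_in {1..i}"
    and "J\<^sub>i \<equiv> tail_ideal n i"
  assumes "1 \<le> i" and "i \<le> n"
  shows "(\<forall>J. ideal J R \<and> J \<subseteq> J\<^sub>i \<longrightarrow>
            J_reduced R J (\<Gamma>\<lparr>carrier := \<Gamma>\<^sub>i\<rparr>) \<and> \<Gamma>\<^sub>i \<subseteq> ideal_perp \<Gamma> J)
       \<and> (\<forall>W. submodule W R \<Gamma> \<and> W \<subseteq> \<Gamma>\<^sub>i \<longrightarrow>
            J_reduced R J\<^sub>i (\<Gamma>\<lparr>carrier := W\<rparr>) \<and> J\<^sub>i \<subseteq> module_perp R \<Gamma> W)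
       \<and> (is_largest_J_reduced_submodule R J\<^sub>i \<Gamma> \<Gamma>\<^sub>i \<and> \<Gamma>\<^sub>i \<subseteq> ideal_perp \<Gamma> J\<^sub>i)
       \<and> reduced_part R \<Gamma> = range Const"
proof (intro conjI allI impI)
  have ann: "apolar r m = 0" if "r \<in> J\<^sub>i" "m \<in> \<Gamma>\<^sub>i" for r m
    using tail_ideal_annihilates[OF \<open>i \<le> n\<close>] that by (simp add: \<Gamma>\<^sub>i_def J\<^sub>i_def)
  have sub: "\<Gamma>\<^sub>i \<subseteq> carrier \<Gamma>"
    using polys_in_mono[of "{1..i}" "{1..n}"] \<open>i \<le> n\<close> by (simp add: \<Gamma>\<^sub>i_def \<Gamma>_def)
  have J_sub: "J\<^sub>i \<subseteq> carrier R"
    unfolding J\<^sub>i_def R_def by (rule ideal.Icarr[OF ideal_tail_ideal, THEN subsetI])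
  \<comment> \<open>The conclusion of reducedness holds outright, since \<open>J\<close> annihilates
    all of \<open>W\<close>.\<close>
  have red: "J_reduced R J (\<Gamma>\<lparr>carrier := W\<rparr>)" if "J \<subseteq> J\<^sub>i" "W \<subseteq> \<Gamma>\<^sub>i" for J W
    using ann that by (auto simp: J_reduced_def \<Gamma>_def)
  have perp: "\<Gamma>\<^sub>i \<subseteq> ideal_perp \<Gamma> J" if "J \<subseteq> J\<^sub>i" for J
    using ann sub that by (auto simp: ideal_perp_def \<Gamma>_def)
  show "J_reduced R J (\<Gamma>\<lparr>carrier := \<Gamma>\<^sub>i\<rparr>)" "\<Gamma>\<^sub>i \<subseteq> ideal_perp \<Gamma> J" if "ideal J R \<and> J \<subseteq> J\<^sub>i" for J
    using that red perp by auto
  show "J_reduced R J\<^sub>i (\<Gamma>\<lparr>carrier := W\<rparr>)" "J\<^sub>i \<subseteq> module_perp R \<Gamma> W"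
    if "submodule W R \<Gamma> \<and> W \<subseteq> \<Gamma>\<^sub>i" for W
    using that red ann J_sub by (auto simp: module_perp_def \<Gamma>_def)
  show "is_largest_J_reduced_submodule R J\<^sub>i \<Gamma> \<Gamma>\<^sub>i"
    unfolding is_largest_J_reduced_submodule_def
    using submodule_polys_in[OF \<open>i \<le> n\<close>] red J_reduced_submodule_subset[OF \<open>i \<le> n\<close>]
    by (auto simp: R_def \<Gamma>_def \<Gamma>\<^sub>i_def J\<^sub>i_def)
  show "\<Gamma>\<^sub>i \<subseteq> ideal_perp \<Gamma> J\<^sub>i"
    by (rule perp) simp
  show "reduced_part R \<Gamma> = range Const"
    unfolding R_def \<Gamma>_def by (rule reduced_part_apolar_module)
qed

end
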